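(* Let $g_i:\mathbb{R}^n\to\mathbb{R}$, $i=1,\dots,m$, be convex functions, let $p\ge 2$, and let $\overline b\in\mathbb{R}^m\setminus\Theta_c$. Then $$d_p(\overline b,\Theta_c)^p=\inf_{x\in\mathbb{R}^n}\sum_{i=1}^m[g_i(x)-\overline b_i]_+^p .$$
   Context: For $b=(b_i)_{i=1,\dots,m}\in\mathbb{R}^m$, $\sigma(b)$ denotes the inequality system $\{g_i(x)\le b_i,\ i=1,\dots,m\}$ in the unknown $x\in\mathbb{R}^n$; it is consistent if it has at least one solution. $\Theta_c=\{b\in\mathbb{R}^m:\sigma(b)\text{ is consistent}\}$. $p$ is a (finite) real number, $\|\cdot\|_p$ is the $p$-norm on $\mathbb{R}^m$, and $d_p(\overline b,\Theta_c)=\inf\{\|\overline b-b\|_p: b\in\Theta_c\}$. $[t]_+=\max\{t,0\}$ and $[t]_+^p=([t]_+)^p$. *)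

theory Defs
  imports "HOL-Analysis.Analysis"
begin

definition consistent :: "('m::finite \<Rightarrow> real ^ 'n \<Rightarrow> real) \<Rightarrow> real ^ 'm \<Rightarrow> bool" where
  "consistent g b \<longleftrightarrow> (\<exists>x. \<forall>i. g i x \<le> b $ i)"

definition consistent_rhs :: "('m::finite \<Rightarrow> real ^ 'n \<Rightarrow> real) \<Rightarrow> (real ^ 'm) set" where
  "consistent_rhs g = {b. consistent g b}"

text \<open>The norm built into the type \<^typ>\<open>real ^ 'm\<close> is the Euclidean one. The \<open>p\<close>-norm below is the
  usual one for finite \<open>p \<ge> 1\<close>; since \<open>0 powr p = 0\<close>, zero components contribute nothing.\<close>

definition p_norm :: "real \<Rightarrow> real ^ 'm::finite \<Rightarrow> real" where
  "p_norm p v = (\<Sum>i\<in>UNIV. \<bar>v $ i\<bar> powr p) powr (1 / p)"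

text \<open>The infimum is taken in the reals, so it is meaningful only for nonempty \<open>S\<close>. The set
  \<open>consistent_rhs g\<close> is never empty: it contains the vector with components \<open>g i x\<close> for every \<open>x\<close>.\<close>

definition p_dist :: "real \<Rightarrow> real ^ 'm::finite \<Rightarrow> (real ^ 'm) set \<Rightarrow> real" where
  "p_dist p a S = (INF b\<in>S. p_norm p (a - b))"

end

theory Submission
  imports Defs
begin

text \<open>
  Fix a point \<open>x\<close>. The right-hand sides for which \<open>x\<close> is a solution form the orthant
  \<open>{c. \<forall>i. g i x \<le> c $ i}\<close>, and the consistent right-hand sides are the union of these orthants
  over all \<open>x\<close>. The point of one orthant nearest to \<open>b\<close> can be found coordinate by coordinate: a
  coordinate \<open>b $ i\<close> that is too small is raised to \<open>g i x\<close>, the others stay. So the \<open>p\<close>-th power of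
  the distance from \<open>b\<close> to the orthant of \<open>x\<close> is the sum of the \<open>max (g i x - b $ i) 0 powr p\<close>
  (lemmas \<open>raised_rhs_attains_violation\<close> and \<open>violation_le_p_norm\<close>). The distance to a union is the
  infimum of the distances, and the increasing map \<open>\<lambda>t. t powr p\<close> on the nonnegative reals commutes
  with this infimum (lemma \<open>p_dist_consistent_rhs_powr\<close>).
\<close>

lemma p_norm_nonneg: "0 \<le> p_norm p v"
  by (simp add: p_norm_def)

lemma p_norm_powr:
  assumes "p > 0"
  shows "p_norm p v powr p = (\<Sum>i\<in>UNIV. \<bar>v $ i\<bar> powr p)"
  using assms by (simp add: p_norm_def powr_powr sum_nonneg)

lemma raised_rhs_attains_violation:
  fixes g :: "'m::finite \<Rightarrow> real ^ 'n \<Rightarrow> real" and b :: "real ^ 'm"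
  assumes "p > 0"
  obtains c where "c \<in> consistent_rhs g"
    and "p_norm p (b - c) powr p = (\<Sum>i\<in>UNIV. max (g i x - b $ i) 0 powr p)"
proof
  let ?c = "(\<chi> i. max (g i x) (b $ i)) :: real ^ 'm"
  show "?c \<in> consistent_rhs g"
    unfolding consistent_rhs_def consistent_def by (auto intro: exI[of _ x])
  have "\<bar>(b - ?c) $ i\<bar> = max (g i x - b $ i) 0" for i
    by (simp add: max_def)
  then show "p_norm p (b - ?c) powr p = (\<Sum>i\<in>UNIV. max (g i x - b $ i) 0 powr p)"
    by (simp only: p_norm_powr[OF assms])
qed

lemma violation_le_p_norm:
  fixes g :: "'m::finite \<Rightarrow> real ^ 'n \<Rightarrow> real" and b c :: "real ^ 'm"
  assumes "p > 0" and "\<And>i. g i x \<le> c $ i"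
  shows "(\<Sum>i\<in>UNIV. max (g i x - b $ i) 0 powr p) \<le> p_norm p (b - c) powr p"
  unfolding p_norm_powr[OF assms(1)]
proof (intro sum_mono powr_mono2)
  fix i
  show "max (g i x - b $ i) 0 \<le> \<bar>(b - c) $ i\<bar>"
    using assms(2)[of i] by simp
qed (use assms(1) in auto)

lemma p_dist_consistent_rhs_powr:
  fixes g :: "'m::finite \<Rightarrow> real ^ 'n \<Rightarrow> real" and b :: "real ^ 'm"
  assumes "p > 0"
  shows "p_dist p b (consistent_rhs g) powr p
    = (INF x. \<Sum>i\<in>UNIV. max (g i x - b $ i) 0 powr p)"
    (is "?d powr p = (INF x. ?F x)")
proof (rule antisym)
  have nonempty: "consistent_rhs g \<noteq> {}"
    using raised_rhs_attains_violation[OF assms] by blast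
  have d_le: "?d \<le> p_norm p (b - c)" if "c \<in> consistent_rhs g" for c
    unfolding p_dist_def using that
    by (intro cINF_lower bdd_belowI2[where m = 0] p_norm_nonneg)
  have d_nonneg: "0 \<le> ?d"
    unfolding p_dist_def using nonempty by (intro cINF_greatest p_norm_nonneg)
  have F_nonneg: "0 \<le> ?F x" for x
    by (simp add: sum_nonneg)

  show "?d powr p \<le> (INF x. ?F x)"
  proof (rule cINF_greatest)
    fix x
    obtain c where "c \<in> consistent_rhs g" and "p_norm p (b - c) powr p = ?F x"
      using raised_rhs_attains_violation[OF assms] .
    then show "?d powr p \<le> ?F x"
      using powr_mono2[OF _ d_nonneg d_le] assms by (metis less_imp_le)
  qed simp

  have inf_nonneg: "0 \<le> (INF x. ?F x)"
    by (intro cINF_greatest F_nonneg) simp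
  \<comment> \<open>The root is taken here because \<open>?d\<close> is an infimum of norms, not of their \<open>p\<close>-th powers.\<close>
  have "(INF x. ?F x) powr (1 / p) \<le> p_norm p (b - c)" if c: "c \<in> consistent_rhs g" for c
  proof -
    obtain x where x: "\<forall>i. g i x \<le> c $ i"
      using c unfolding consistent_rhs_def consistent_def by auto
    have "(INF x. ?F x) \<le> ?F x"
      by (intro cINF_lower bdd_belowI2[where m = 0] F_nonneg) simp
    also have "\<dots> \<le> p_norm p (b - c) powr p"
      using assms x by (intro violation_le_p_norm) auto
    finally have "(INF x. ?F x) powr (1 / p) \<le> (p_norm p (b - c) powr p) powr (1 / p)"
      using assms inf_nonneg by (intro powr_mono2) auto
    also have "\<dots> = p_norm p (b - c)"
      using assms by (simp add: powr_powr p_norm_nonneg)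
    finally show ?thesis .
  qed
  then have "(INF x. ?F x) powr (1 / p) \<le> ?d"
    unfolding p_dist_def using nonempty by (intro cINF_greatest)
  then have "((INF x. ?F x) powr (1 / p)) powr p \<le> ?d powr p"
    using assms by (intro powr_mono2) auto
  then show "(INF x. ?F x) \<le> ?d powr p"
    using assms inf_nonneg by (simp add: powr_powr)
qed

theorem proposition23:
  fixes g :: "'m::finite \<Rightarrow> real ^ 'n::finite \<Rightarrow> real"
    and p :: real
    and b :: "real ^ 'm"
  assumes "\<And>i. convex_on UNIV (g i)"
    and "p \<ge> 2"
    and "b \<notin> consistent_rhs g"
  shows "p_dist p b (consistent_rhs g) powr p
    = (INF x. \<Sum>i\<in>UNIV. max (g i x - b $ i) 0 powr p)"
  using assms(2) by (intro p_dist_consistent_rhs_powr) simp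

end
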